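(* Let $k$ be a field, $\Psi$ a set, and $k(\Psi)$ the field of rational functions over $k$ in the variables indexed by $\Psi$, on which the group $\mathfrak S_\Psi$ of all permutations of $\Psi$ acts by permuting the variables. For $d\in\mathbb Z$ let $V_d\subseteq k(\Psi)$ be the ($\mathfrak S_\Psi$-invariant) set of homogeneous rational functions of degree $d$. Then any smooth irreducible ($k$-linear) representation of $\mathfrak S_\Psi$ over $k$ can be embedded ($k$-linearly and $\mathfrak S_\Psi$-equivariantly) into the $V_0$-semilinear representation $V_d\subset k(\Psi)$ for some integer $d$.
   Context: $\mathfrak S_\Psi$ carries the topology in which the pointwise stabilizers of finite subsets of $\Psi$ form a base of neighbourhoods of the identity. A representation is smooth if the stabilizer of every vector is open. A rational function is homogeneous of degree $d$ if it is $0$ or a ratio of homogeneous polynomials $P/Q$ with $\deg P-\deg Q=d$ (each variable having degree $1$). *)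

theory Defs
  imports
    "HOL-Library.Poly_Mapping"
    "HOL-Computational_Algebra.Fraction_Field"
    "HOL-Combinatorics.Permutations"
    "HOL-Analysis.Abstract_Topology"
begin

hide_const (open) Rat.Fract

section \<open>Polynomials in an arbitrary family of variables\<close>

text \<open>
  The type \<^typ>\<open>('x \<Rightarrow>\<^sub>0 nat) \<Rightarrow>\<^sub>0 'k\<close> is a copy of the polynomial ring over \<open>'k\<close> with one
  variable for each element of \<open>'x\<close>, but the library makes it an integral domain only if
  \<open>'x\<close> is linearly ordered. The copy below is an integral domain for every \<open>'x\<close>.
\<close>

typedef (overloaded) ('x, 'k) mpoly = "UNIV :: (('x \<Rightarrow>\<^sub>0 nat) \<Rightarrow>\<^sub>0 'k::zero) set"
  morphisms mapping_of MPoly ..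

setup_lifting type_definition_mpoly

instantiation mpoly :: (type, comm_ring_1) comm_ring_1
begin
lift_definition zero_mpoly :: "('a, 'b) mpoly" is 0 .
lift_definition one_mpoly :: "('a, 'b) mpoly" is 1 .
lift_definition plus_mpoly :: "('a, 'b) mpoly \<Rightarrow> ('a, 'b) mpoly \<Rightarrow> ('a, 'b) mpoly" is "(+)" .
lift_definition minus_mpoly :: "('a, 'b) mpoly \<Rightarrow> ('a, 'b) mpoly \<Rightarrow> ('a, 'b) mpoly" is "(-)" .
lift_definition uminus_mpoly :: "('a, 'b) mpoly \<Rightarrow> ('a, 'b) mpoly" is uminus .
lift_definition times_mpoly :: "('a, 'b) mpoly \<Rightarrow> ('a, 'b) mpoly \<Rightarrow> ('a, 'b) mpoly" is "(*)" .
instance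
  by intro_classes (transfer; simp add: algebra_simps)+
end

lemma poly_mapping_mult_nonzero:
  fixes f g :: "('x \<Rightarrow>\<^sub>0 nat) \<Rightarrow>\<^sub>0 'k::idom"
  assumes "f \<noteq> 0" "g \<noteq> 0"
  shows "f * g \<noteq> 0"
proof -
  let ?F = "Poly_Mapping.keys f" and ?G = "Poly_Mapping.keys g"
  define V where "V = (\<Union>m \<in> ?F \<union> ?G. Poly_Mapping.keys m)"
  have "finite V" unfolding V_def by auto
  then obtain e where e: "bij_betw e {0..<card V} V"
    using ex_bij_betw_nat_finite by blast
  define h :: "('x \<Rightarrow>\<^sub>0 nat) \<Rightarrow> (nat \<Rightarrow>\<^sub>0 nat)" where
    "h = (\<lambda>m. Abs_poly_mapping (\<lambda>n. if n < card V then Poly_Mapping.lookup m (e n) else 0))"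
  have lookup_h: "Poly_Mapping.lookup (h m) = (\<lambda>n. if n < card V then Poly_Mapping.lookup m (e n) else 0)" for m
    unfolding h_def by (rule lookup_Abs_poly_mapping) (rule finite_subset[of _ "{..<card V}"], auto)
  have h_add: "h (m + m') = h m + h m'" for m m'
    by (rule poly_mapping_eqI) (simp add: lookup_h lookup_add)
  have h_inj: "m = m'" if "h m = h m'" "m \<in> ?F \<union> ?G" "m' \<in> ?F \<union> ?G" for m m'
  proof (rule poly_mapping_eqI)
    fix x
    show "Poly_Mapping.lookup m x = Poly_Mapping.lookup m' x"
    proof (cases "x \<in> V")
      case True
      then obtain n where n: "n < card V" "x = e n"
        using e unfolding bij_betw_def by (metis atLeastLessThan_iff imageE)
      have "Poly_Mapping.lookup (h m) n = Poly_Mapping.lookup (h m') n" using that by simp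
      then show ?thesis using n by (simp add: lookup_h)
    next
      case False
      then show ?thesis using that by (auto simp: V_def in_keys_iff)
    qed
  qed
  have ne: "?F \<noteq> {}" "?G \<noteq> {}" using assms by auto
  have "Max (h ` ?F) \<in> h ` ?F" "Max (h ` ?G) \<in> h ` ?G" using ne by (auto intro!: Max_in)
  then obtain a b where a: "a \<in> ?F" "h a = Max (h ` ?F)" and b: "b \<in> ?G" "h b = Max (h ` ?G)"
    by (metis imageE)
  have a_max: "h m \<le> h a" if "m \<in> ?F" for m using that a by simp
  have b_max: "h m \<le> h b" if "m \<in> ?G" for m using that b by simp
  have uniq: "c = a \<and> d = b" if "c \<in> ?F" "d \<in> ?G" "a + b = c + d" for c d
  proof -
    have eq: "h a + h b = h c + h d" using that(3) h_add by metis
    have "h c = h a"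
    proof (rule ccontr)
      assume "h c \<noteq> h a"
      then have "h c < h a" using a_max[OF that(1)] by simp
      then have "h c + h d < h a + h b"
        using b_max[OF that(2)] by (rule add_less_le_mono)
      with eq show False by simp
    qed
    then have "c = a" using h_inj that a by blast
    with that(3) show ?thesis by simp
  qed
  have "Poly_Mapping.lookup (f * g) (a + b) =
      (\<Sum>(c, d). Poly_Mapping.lookup f c * Poly_Mapping.lookup g d when a + b = c + d)"
    by (simp add: times_poly_mapping.rep_eq prod_fun_unfold_prod)
  also have "\<dots> = (\<Sum>cd. (case cd of (c, d) \<Rightarrow> Poly_Mapping.lookup f c * Poly_Mapping.lookup g d) when cd = (a, b))"
  proof (rule Sum_any.cong)
    fix cd :: "('x \<Rightarrow>\<^sub>0 nat) \<times> ('x \<Rightarrow>\<^sub>0 nat)"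
    obtain c d where [simp]: "cd = (c, d)" by (cases cd)
    show "(case cd of (c, d) \<Rightarrow> Poly_Mapping.lookup f c * Poly_Mapping.lookup g d when a + b = c + d) =
      ((case cd of (c, d) \<Rightarrow> Poly_Mapping.lookup f c * Poly_Mapping.lookup g d) when cd = (a, b))"
      using uniq[of c d] by (auto simp: when_def in_keys_iff)
  qed
  also have "\<dots> = Poly_Mapping.lookup f a * Poly_Mapping.lookup g b" by simp
  also have "\<dots> \<noteq> 0" using a b by (simp add: in_keys_iff)
  finally show ?thesis by auto
qed

instance mpoly :: (type, idom) idom
  by intro_classes (transfer, rule poly_mapping_mult_nonzero)

lift_definition mpoly_const :: "'k::comm_ring_1 \<Rightarrow> ('x, 'k) mpoly"
  is "\<lambda>c. Poly_Mapping.single 0 c" .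

lift_definition mpoly_var :: "'x \<Rightarrow> ('x, 'k::comm_ring_1) mpoly"
  is "\<lambda>x. Poly_Mapping.single (Poly_Mapping.single x 1) 1" .

definition mpoly_monoms :: "('x, 'k::comm_ring_1) mpoly \<Rightarrow> ('x \<Rightarrow>\<^sub>0 nat) set" where
  "mpoly_monoms P = Poly_Mapping.keys (mapping_of P)"

definition mpoly_vars :: "('x, 'k::comm_ring_1) mpoly \<Rightarrow> 'x set" where
  "mpoly_vars P = (\<Union>m \<in> mpoly_monoms P. Poly_Mapping.keys m)"

definition monom_degree :: "('x \<Rightarrow>\<^sub>0 nat) \<Rightarrow> nat" where
  "monom_degree m = (\<Sum>x \<in> Poly_Mapping.keys m. Poly_Mapping.lookup m x)"

text \<open>As usual, the zero polynomial is homogeneous of every degree.\<close>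

definition homogeneous_mpoly :: "nat \<Rightarrow> ('x, 'k::comm_ring_1) mpoly \<Rightarrow> bool" where
  "homogeneous_mpoly n P \<longleftrightarrow> (\<forall>m \<in> mpoly_monoms P. monom_degree m = n)"

text \<open>
  For a bijection \<open>g\<close> of \<open>'x\<close>, the following is the ring automorphism with
  \<open>x \<mapsto> g x\<close> on variables: \<open>map_key g m\<close> is the monomial \<open>m\<close> with every
  variable \<open>x\<close> replaced by the preimage of \<open>x\<close> under \<open>g\<close>, and the coefficient of
  \<open>m\<close> in the result is the coefficient of \<open>map_key g m\<close> in the argument
  (see \<open>mpoly_rename_var\<close> and \<open>mpoly_rename_mult\<close> below).
\<close>

lift_definition mpoly_rename :: "('x \<Rightarrow> 'x) \<Rightarrow> ('x, 'k::comm_ring_1) mpoly \<Rightarrow> ('x, 'k) mpoly"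
  is "\<lambda>g. Poly_Mapping.map_key (Poly_Mapping.map_key g)" .

lemma lookup_map_key: "inj f \<Longrightarrow> Poly_Mapping.lookup (Poly_Mapping.map_key f p) x = Poly_Mapping.lookup p (f x)"
  by (simp add: map_key.rep_eq)

lemma inj_map_key:
  assumes "bij g"
  shows "inj (Poly_Mapping.map_key g :: ('x \<Rightarrow>\<^sub>0 'c::zero) \<Rightarrow> _)"
proof (rule injI, rule poly_mapping_eqI)
  fix p q :: "'x \<Rightarrow>\<^sub>0 'c" and y
  assume eq: "Poly_Mapping.map_key g p = Poly_Mapping.map_key g q"
  obtain x where "y = g x" using assms by (meson bij_pointE)
  then show "Poly_Mapping.lookup p y = Poly_Mapping.lookup q y"
    using arg_cong[OF eq, of "\<lambda>r. Poly_Mapping.lookup r x"] assms by (simp add: lookup_map_key bij_is_inj)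
qed

lemma map_key_inv:
  assumes "bij g"
  shows "Poly_Mapping.map_key g (Poly_Mapping.map_key (inv g) p) = p"
proof -
  have "inj g" "inj (inv g)" using assms by (auto simp: bij_is_inj bij_imp_bij_inv)
  then show ?thesis using assms
    by (intro poly_mapping_eqI) (simp add: lookup_map_key)
qed

lemma bij_map_key:
  assumes "bij g"
  shows "bij (Poly_Mapping.map_key g :: ('x \<Rightarrow>\<^sub>0 'c::zero) \<Rightarrow> _)"
  using inj_map_key[OF assms] map_key_inv[OF assms] by (metis bijI surjI)

lemma mpoly_rename_add: "bij g \<Longrightarrow> mpoly_rename g (P + Q) = mpoly_rename g P + mpoly_rename g Q"
  by transfer (simp add: map_key_plus inj_map_key)

lemma mpoly_rename_mult:
  fixes P Q :: "('x, 'k::comm_ring_1) mpoly"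
  assumes "bij g"
  shows "mpoly_rename g (P * Q) = mpoly_rename g P * mpoly_rename g Q"
proof (transfer fixing: g)
  fix p q :: "('x \<Rightarrow>\<^sub>0 nat) \<Rightarrow>\<^sub>0 'k"
  let ?k = "Poly_Mapping.map_key g :: ('x \<Rightarrow>\<^sub>0 nat) \<Rightarrow> _"
  have inj: "inj ?k" and bij: "bij ?k" and injg: "inj g"
    using assms by (auto simp: inj_map_key bij_map_key bij_is_inj)
  have *: "?k a = ?k b + ?k c \<longleftrightarrow> a = b + c" for a b c
    using inj injg by (metis injD map_key_plus)
  show "Poly_Mapping.map_key ?k (p * q) = Poly_Mapping.map_key ?k p * Poly_Mapping.map_key ?k q"
  proof (rule poly_mapping_eqI)
    fix m
    have in1: "(\<Sum>b. Poly_Mapping.lookup q b when ?k m = ?k l + b) =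
        (\<Sum>b. Poly_Mapping.lookup q (?k b) when m = l + b)" for l
      by (rule Sum_any.reindex_cong[of ?k]) (use bij * in \<open>auto simp: fun_eq_iff bij_def\<close>)
    have "Poly_Mapping.lookup (p * q) (?k m) =
        (\<Sum>l. Poly_Mapping.lookup p l * (\<Sum>b. Poly_Mapping.lookup q b when ?k m = l + b))"
      by (simp add: lookup_mult)
    also have "\<dots> = (\<Sum>l. Poly_Mapping.lookup p (?k l) * (\<Sum>b. Poly_Mapping.lookup q b when ?k m = ?k l + b))"
      by (rule Sum_any.reindex_cong[of ?k]) (use bij in \<open>auto simp: fun_eq_iff bij_def\<close>)
    finally show "Poly_Mapping.lookup (Poly_Mapping.map_key ?k (p * q)) m =
        Poly_Mapping.lookup (Poly_Mapping.map_key ?k p * Poly_Mapping.map_key ?k q) m"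
      using inj by (simp add: lookup_map_key lookup_mult in1)
  qed
qed

lemma mpoly_rename_var:
  assumes "bij g"
  shows "mpoly_rename g (mpoly_var x) = (mpoly_var (g x) :: ('x, 'k::comm_ring_1) mpoly)"
proof (transfer fixing: g x)
  let ?k = "Poly_Mapping.map_key g :: ('x \<Rightarrow>\<^sub>0 nat) \<Rightarrow> _"
  have "?k (Poly_Mapping.single (g x) 1) = Poly_Mapping.single x 1"
    using assms by (simp add: bij_is_inj)
  then show "Poly_Mapping.map_key ?k (Poly_Mapping.single (Poly_Mapping.single x 1) 1) =
      (Poly_Mapping.single (Poly_Mapping.single (g x) 1) 1 :: ('x \<Rightarrow>\<^sub>0 nat) \<Rightarrow>\<^sub>0 'k)"
    using map_key_single[OF inj_map_key[OF assms]] by metis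
qed

lemma mpoly_rename_const:
  assumes "bij g"
  shows "mpoly_rename g (mpoly_const c) = (mpoly_const c :: ('x, 'k::comm_ring_1) mpoly)"
proof (transfer fixing: g c)
  let ?k = "Poly_Mapping.map_key g :: ('x \<Rightarrow>\<^sub>0 nat) \<Rightarrow> _"
  have "?k 0 = 0" using assms by (simp add: bij_is_inj)
  then show "Poly_Mapping.map_key ?k (Poly_Mapping.single 0 c) = Poly_Mapping.single 0 c"
    using map_key_single[OF inj_map_key[OF assms]] by metis
qed

lemma mpoly_rename_0: "bij g \<Longrightarrow> mpoly_rename g 0 = 0"
  by transfer (simp add: inj_map_key)

lemma mpoly_const_0: "mpoly_const 0 = 0"
  by transfer simp

lemma mpoly_const_1: "mpoly_const 1 = 1"
  by transfer simp

lemma mpoly_const_add: "mpoly_const (a + b) = mpoly_const a + mpoly_const b"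
  by transfer (simp add: single_add)

lemma mpoly_const_mult: "mpoly_const (a * b) = mpoly_const a * mpoly_const b"
  by transfer (simp add: mult_single)

lemma mpoly_rename_compose:
  assumes "bij g" "bij h"
  shows "mpoly_rename (g \<circ> h) P = mpoly_rename g (mpoly_rename h P)"
proof (transfer fixing: g h)
  fix P :: "('a \<Rightarrow>\<^sub>0 nat) \<Rightarrow>\<^sub>0 'b"
  have eq: "Poly_Mapping.map_key (g \<circ> h) = (Poly_Mapping.map_key h \<circ> Poly_Mapping.map_key g :: ('a \<Rightarrow>\<^sub>0 nat) \<Rightarrow> _)"
    using assms by (simp add: fun_eq_iff map_key_compose bij_is_inj)
  show "Poly_Mapping.map_key (Poly_Mapping.map_key (g \<circ> h)) P =
      Poly_Mapping.map_key (Poly_Mapping.map_key g) (Poly_Mapping.map_key (Poly_Mapping.map_key h) P)"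
    unfolding eq by (rule map_key_compose[symmetric]) (use assms in \<open>auto simp: inj_map_key\<close>)
qed

lemma mpoly_rename_id: "mpoly_rename id P = P"
proof (transfer)
  fix P :: "('a \<Rightarrow>\<^sub>0 nat) \<Rightarrow>\<^sub>0 'b"
  have "Poly_Mapping.map_key id = (\<lambda>x. x :: 'a \<Rightarrow>\<^sub>0 nat)"
    by (simp add: fun_eq_iff id_def map_key_id)
  then show "Poly_Mapping.map_key (Poly_Mapping.map_key id) P = P"
    by (simp add: map_key_id)
qed

lemma mpoly_rename_eq_0_iff:
  assumes "bij g"
  shows "mpoly_rename g P = 0 \<longleftrightarrow> P = 0"
proof
  assume "mpoly_rename g P = 0"
  then have "mpoly_rename (inv g) (mpoly_rename g P) = 0"
    using assms by (simp add: mpoly_rename_0 bij_imp_bij_inv)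
  then show "P = 0" using assms
    by (simp add: mpoly_rename_compose[symmetric] bij_imp_bij_inv mpoly_rename_id bij_is_inj)
qed (simp add: assms mpoly_rename_0)

lemma mpoly_monoms_rename:
  "bij g \<Longrightarrow> mpoly_monoms (mpoly_rename g P) = Poly_Mapping.map_key g -` mpoly_monoms P"
  by (simp add: mpoly_monoms_def mpoly_rename.rep_eq keys_map_key inj_map_key)

lemma monom_degree_map_key:
  assumes "bij g"
  shows "monom_degree (Poly_Mapping.map_key g m) = monom_degree m"
proof -
  have g: "inj g" "surj g" using assms by (auto simp: bij_def)
  have "bij_betw g (g -` Poly_Mapping.keys m) (Poly_Mapping.keys m)"
    using g inj_on_subset[of g UNIV] by (simp add: bij_betw_def surj_image_vimage_eq)
  then have "(\<Sum>x \<in> g -` Poly_Mapping.keys m. Poly_Mapping.lookup m (g x)) =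
      (\<Sum>x \<in> Poly_Mapping.keys m. Poly_Mapping.lookup m x)"
    by (rule sum.reindex_bij_betw)
  then show ?thesis
    using g by (simp add: monom_degree_def keys_map_key lookup_map_key)
qed

section \<open>Rational functions\<close>

type_synonym ('x, 'k) ratfun = "('x, 'k) mpoly fract"

definition ratfun_scale :: "'k::field \<Rightarrow> ('x, 'k) ratfun \<Rightarrow> ('x, 'k) ratfun" where
  "ratfun_scale c f = Fract (mpoly_const c) 1 * f"

text \<open>
  The action on a fraction is computed on an arbitrary representative; for a bijection
  \<open>g\<close> it does not depend on the representative, see \<open>ratfun_act_Fract\<close>.
\<close>

definition ratfun_act :: "('x \<Rightarrow> 'x) \<Rightarrow> ('x, 'k::field) ratfun \<Rightarrow> ('x, 'k) ratfun" where
  "ratfun_act g f =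
    (THE h. \<exists>P Q. Q \<noteq> 0 \<and> f = Fract P Q \<and> h = Fract (mpoly_rename g P) (mpoly_rename g Q))"

lemma ratfun_act_Fract:
  assumes "bij g" "Q \<noteq> 0"
  shows "ratfun_act g (Fract P Q) = Fract (mpoly_rename g P) (mpoly_rename g Q)"
  unfolding ratfun_act_def
proof (rule the_equality)
  fix h
  assume "\<exists>P' Q'. Q' \<noteq> 0 \<and> Fract P Q = Fract P' Q' \<and> h = Fract (mpoly_rename g P') (mpoly_rename g Q')"
  then obtain P' Q' where *: "Q' \<noteq> 0" "Fract P Q = Fract P' Q'"
    "h = Fract (mpoly_rename g P') (mpoly_rename g Q')" by blast
  then have "P * Q' = P' * Q" using assms by (simp add: eq_fract)
  then have "mpoly_rename g P * mpoly_rename g Q' = mpoly_rename g P' * mpoly_rename g Q"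
    using assms by (metis mpoly_rename_mult)
  then show "h = Fract (mpoly_rename g P) (mpoly_rename g Q)"
    using * assms by (simp add: eq_fract mpoly_rename_eq_0_iff)
qed (use assms in blast)

lemma ratfun_act_add:
  assumes "bij g"
  shows "ratfun_act g (f + f') = ratfun_act g f + ratfun_act g f'"
  using assms
  by (cases f; cases f')
    (simp add: ratfun_act_Fract mpoly_rename_add mpoly_rename_mult mpoly_rename_eq_0_iff)

lemma ratfun_act_mult:
  assumes "bij g"
  shows "ratfun_act g (f * f') = ratfun_act g f * ratfun_act g f'"
  using assms
  by (cases f; cases f') (simp add: ratfun_act_Fract mpoly_rename_mult)

lemma ratfun_act_compose:
  assumes "bij g" "bij h"
  shows "ratfun_act (g \<circ> h) f = ratfun_act g (ratfun_act h f)"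
  using assms
  by (cases f) (simp add: ratfun_act_Fract mpoly_rename_compose mpoly_rename_eq_0_iff bij_comp)

lemma ratfun_act_id: "ratfun_act id f = f"
  by (cases f) (simp add: ratfun_act_Fract mpoly_rename_id)

lemma mpoly_rename_1: "bij g \<Longrightarrow> mpoly_rename g 1 = 1"
  using mpoly_rename_const[of g 1] by (simp add: mpoly_const_1)

lemma ratfun_act_scale:
  assumes "bij g"
  shows "ratfun_act g (ratfun_scale c f) = ratfun_scale c (ratfun_act g f)"
  using assms
  by (simp add: ratfun_scale_def ratfun_act_mult ratfun_act_Fract mpoly_rename_const mpoly_rename_1)

lemma vector_space_ratfun_scale:
  "vector_space (ratfun_scale :: 'k::field \<Rightarrow> ('x, 'k) ratfun \<Rightarrow> ('x, 'k) ratfun)"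
proof
  fix a b :: 'k and f f' :: "('x, 'k) ratfun"
  show "ratfun_scale a (f + f') = ratfun_scale a f + ratfun_scale a f'"
    by (simp add: ratfun_scale_def distrib_left)
  have "Fract (mpoly_const (a + b)) 1 = Fract (mpoly_const a) 1 + Fract (mpoly_const b :: ('x, 'k) mpoly) 1"
    by (simp add: mpoly_const_add)
  then show "ratfun_scale (a + b) f = ratfun_scale a f + ratfun_scale b f"
    by (simp only: ratfun_scale_def distrib_right)
  show "ratfun_scale a (ratfun_scale b f) = ratfun_scale (a * b) f"
    by (simp add: ratfun_scale_def mpoly_const_mult flip: mult.assoc)
  show "ratfun_scale 1 f = f"
    by (simp add: ratfun_scale_def mpoly_const_1 One_fract_def[symmetric])
qed

text \<open>
  \<open>homogeneous_ratfuns \<Psi> d\<close> is the set \<open>V\<^sub>d\<close> of homogeneous rational functions of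
  degree \<open>d\<close> in the variables indexed by \<open>\<Psi>\<close>. The element \<open>0\<close> is listed separately
  since for \<open>\<Psi> = {}\<close> there is no denominator of positive degree.
\<close>

definition homogeneous_ratfuns :: "'x set \<Rightarrow> int \<Rightarrow> ('x, 'k::field) ratfun set" where
  "homogeneous_ratfuns \<Psi> d = {f. f = 0 \<or>
    (\<exists>P Q m n. mpoly_vars P \<subseteq> \<Psi> \<and> mpoly_vars Q \<subseteq> \<Psi> \<and> Q \<noteq> 0 \<and>
      homogeneous_mpoly m P \<and> homogeneous_mpoly n Q \<and> int m - int n = d \<and> f = Fract P Q)}"

lemma homogeneous_ratfuns_cases:
  assumes "f \<in> homogeneous_ratfuns \<Psi> d"
  obtains "f = 0"
  | P Q m n where "mpoly_vars P \<subseteq> \<Psi>" "mpoly_vars Q \<subseteq> \<Psi>" "Q \<noteq> 0"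
      "homogeneous_mpoly m P" "homogeneous_mpoly n Q" "int m - int n = d" "f = Fract P Q"
  using assms unfolding homogeneous_ratfuns_def by blast

lemma homogeneous_ratfunsI:
  assumes "mpoly_vars P \<subseteq> \<Psi>" "mpoly_vars Q \<subseteq> \<Psi>" "Q \<noteq> 0"
    "homogeneous_mpoly m P" "homogeneous_mpoly n Q" "int m - int n = d"
  shows "Fract P Q \<in> homogeneous_ratfuns \<Psi> d"
  using assms unfolding homogeneous_ratfuns_def by blast

lemma homogeneous_ratfuns_0: "0 \<in> homogeneous_ratfuns \<Psi> d"
  by (simp add: homogeneous_ratfuns_def)

lemma mpoly_vars_rename:
  assumes "g permutes \<Psi>" "mpoly_vars P \<subseteq> \<Psi>"
  shows "mpoly_vars (mpoly_rename g P) \<subseteq> \<Psi>"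
proof
  have g: "bij g" "inj g" using assms(1) by (auto simp: permutes_bij permutes_inj)
  fix y assume "y \<in> mpoly_vars (mpoly_rename g P)"
  then obtain m where m: "Poly_Mapping.map_key g m \<in> mpoly_monoms P" "y \<in> Poly_Mapping.keys m"
    using g by (auto simp: mpoly_vars_def mpoly_monoms_rename)
  obtain x where x: "y = g x" using g by (meson bij_pointE)
  then have "x \<in> Poly_Mapping.keys (Poly_Mapping.map_key g m)"
    using m g by (simp add: keys_map_key)
  then have "x \<in> \<Psi>" using m assms(2) by (auto simp: mpoly_vars_def)
  then show "y \<in> \<Psi>" using assms(1) x by (simp add: permutes_in_image)
qed

lemma homogeneous_mpoly_rename:
  "bij g \<Longrightarrow> homogeneous_mpoly n P \<Longrightarrow> homogeneous_mpoly n (mpoly_rename g P)"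
  by (auto simp: homogeneous_mpoly_def mpoly_monoms_rename) (metis monom_degree_map_key)

lemma ratfun_act_0: "bij g \<Longrightarrow> ratfun_act g 0 = 0"
  by (simp add: Zero_fract_def ratfun_act_Fract mpoly_rename_0 mpoly_rename_1)

lemma homogeneous_ratfuns_act:
  assumes "g permutes \<Psi>" "f \<in> homogeneous_ratfuns \<Psi> d"
  shows "ratfun_act g f \<in> homogeneous_ratfuns \<Psi> d"
proof -
  have g: "bij g" using assms(1) by (rule permutes_bij)
  show ?thesis
  proof (cases "f = 0")
    case True
    then show ?thesis using g by (simp add: ratfun_act_0 homogeneous_ratfuns_def)
  next
    case False
    then obtain P Q m n where *: "mpoly_vars P \<subseteq> \<Psi>" "mpoly_vars Q \<subseteq> \<Psi>" "Q \<noteq> 0"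
      "homogeneous_mpoly m P" "homogeneous_mpoly n Q" "int m - int n = d" "f = Fract P Q"
      using assms(2) by (auto simp: homogeneous_ratfuns_def)
    have "Fract (mpoly_rename g P) (mpoly_rename g Q) \<in> homogeneous_ratfuns \<Psi> d"
      by (rule homogeneous_ratfunsI[where m = m and n = n])
        (simp_all add: * g mpoly_vars_rename[OF assms(1)] homogeneous_mpoly_rename mpoly_rename_eq_0_iff)
    then show ?thesis using * g by (simp add: ratfun_act_Fract)
  qed
qed

lemma mpoly_monoms_mult:
  "mpoly_monoms (P * Q) \<subseteq> {a + b | a b. a \<in> mpoly_monoms P \<and> b \<in> mpoly_monoms Q}"
  unfolding mpoly_monoms_def times_mpoly.rep_eq by (rule keys_mult)

lemma mpoly_monoms_add: "mpoly_monoms (P + Q) \<subseteq> mpoly_monoms P \<union> mpoly_monoms Q"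
  unfolding mpoly_monoms_def plus_mpoly.rep_eq by (rule keys_add)

lemma mpoly_vars_mult: "mpoly_vars (P * Q) \<subseteq> mpoly_vars P \<union> mpoly_vars Q"
proof
  fix x assume "x \<in> mpoly_vars (P * Q)"
  then obtain m where "m \<in> mpoly_monoms (P * Q)" "x \<in> Poly_Mapping.keys m"
    by (auto simp: mpoly_vars_def)
  moreover from this(1) obtain a b where "m = a + b" "a \<in> mpoly_monoms P" "b \<in> mpoly_monoms Q"
    using mpoly_monoms_mult[of P Q] by blast
  ultimately show "x \<in> mpoly_vars P \<union> mpoly_vars Q"
    using Poly_Mapping.keys_add[of a b] by (auto simp: mpoly_vars_def)
qed

lemma mpoly_vars_add: "mpoly_vars (P + Q) \<subseteq> mpoly_vars P \<union> mpoly_vars Q"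
  unfolding mpoly_vars_def using mpoly_monoms_add[of P Q] by fastforce

lemma monom_degree_add: "monom_degree (a + b) = monom_degree a + monom_degree b"
proof -
  have *: "monom_degree m = (\<Sum>x \<in> Poly_Mapping.keys a \<union> Poly_Mapping.keys b. Poly_Mapping.lookup m x)"
    if "Poly_Mapping.keys m \<subseteq> Poly_Mapping.keys a \<union> Poly_Mapping.keys b" for m
    unfolding monom_degree_def using that
    by (intro sum.mono_neutral_left) (auto simp: in_keys_iff)
  show ?thesis
    by (simp add: * keys_add lookup_add sum.distrib)
qed

lemma homogeneous_mpoly_mult:
  "homogeneous_mpoly m P \<Longrightarrow> homogeneous_mpoly n Q \<Longrightarrow> homogeneous_mpoly (m + n) (P * Q)"
  using mpoly_monoms_mult[of P Q] by (fastforce simp: homogeneous_mpoly_def monom_degree_add)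

lemma homogeneous_mpoly_add:
  "homogeneous_mpoly n P \<Longrightarrow> homogeneous_mpoly n Q \<Longrightarrow> homogeneous_mpoly n (P + Q)"
  using mpoly_monoms_add[of P Q] by (fastforce simp: homogeneous_mpoly_def)

lemma homogeneous_ratfuns_mult:
  assumes "f \<in> homogeneous_ratfuns \<Psi> d" "f' \<in> homogeneous_ratfuns \<Psi> d'"
  shows "f * f' \<in> homogeneous_ratfuns \<Psi> (d + d')"
proof (cases "f = 0 \<or> f' = 0")
  case True
  then show ?thesis by (auto simp: homogeneous_ratfuns_0)
next
  case False
  obtain P Q m n where 1: "mpoly_vars P \<subseteq> \<Psi>" "mpoly_vars Q \<subseteq> \<Psi>" "Q \<noteq> 0"
      "homogeneous_mpoly m P" "homogeneous_mpoly n Q" "int m - int n = d" "f = Fract P Q"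
    using assms(1) False by (auto elim: homogeneous_ratfuns_cases)
  obtain P' Q' m' n' where 2: "mpoly_vars P' \<subseteq> \<Psi>" "mpoly_vars Q' \<subseteq> \<Psi>" "Q' \<noteq> 0"
      "homogeneous_mpoly m' P'" "homogeneous_mpoly n' Q'" "int m' - int n' = d'" "f' = Fract P' Q'"
    using assms(2) False by (auto elim: homogeneous_ratfuns_cases)
  have "Fract (P * P') (Q * Q') \<in> homogeneous_ratfuns \<Psi> (d + d')"
    by (rule homogeneous_ratfunsI[where m = "m + m'" and n = "n + n'"])
      (use 1 2 mpoly_vars_mult[of P P'] mpoly_vars_mult[of Q Q'] in \<open>auto intro: homogeneous_mpoly_mult\<close>)
  then show ?thesis using 1 2 by simp
qed

lemma homogeneous_ratfuns_add:
  assumes "f \<in> homogeneous_ratfuns \<Psi> d" "f' \<in> homogeneous_ratfuns \<Psi> d"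
  shows "f + f' \<in> homogeneous_ratfuns \<Psi> d"
proof (cases "f = 0 \<or> f' = 0")
  case True
  then show ?thesis using assms by auto
next
  case False
  obtain P Q m n where 1: "mpoly_vars P \<subseteq> \<Psi>" "mpoly_vars Q \<subseteq> \<Psi>" "Q \<noteq> 0"
      "homogeneous_mpoly m P" "homogeneous_mpoly n Q" "int m - int n = d" "f = Fract P Q"
    using assms(1) False by (auto elim: homogeneous_ratfuns_cases)
  obtain P' Q' m' n' where 2: "mpoly_vars P' \<subseteq> \<Psi>" "mpoly_vars Q' \<subseteq> \<Psi>" "Q' \<noteq> 0"
      "homogeneous_mpoly m' P'" "homogeneous_mpoly n' Q'" "int m' - int n' = d" "f' = Fract P' Q'"
    using assms(2) False by (auto elim: homogeneous_ratfuns_cases)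
  have "m + n' = m' + n" using 1 2 by linarith
  then have "homogeneous_mpoly (m + n') (P * Q' + P' * Q)"
    using 1 2 by (metis homogeneous_mpoly_add homogeneous_mpoly_mult)
  moreover have "mpoly_vars (P * Q' + P' * Q) \<subseteq> \<Psi>"
    using 1 2 mpoly_vars_add[of "P * Q'" "P' * Q"] mpoly_vars_mult[of P Q'] mpoly_vars_mult[of P' Q] by blast
  moreover have "mpoly_vars (Q * Q') \<subseteq> \<Psi>" using 1 2 mpoly_vars_mult[of Q Q'] by blast
  ultimately have "Fract (P * Q' + P' * Q) (Q * Q') \<in> homogeneous_ratfuns \<Psi> d"
    by (intro homogeneous_ratfunsI[where m = "m + n'" and n = "n + n'"])
      (use 1 2 in \<open>auto intro: homogeneous_mpoly_mult\<close>)
  then show ?thesis using 1 2 by simp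
qed

lemma ratfun_const_homogeneous: "Fract (mpoly_const c) 1 \<in> homogeneous_ratfuns \<Psi> 0"
proof -
  have "mpoly_monoms (mpoly_const a :: ('a, 'b) mpoly) \<subseteq> {0}" for a
    by (simp add: mpoly_monoms_def mpoly_const.rep_eq)
  then have "mpoly_vars (mpoly_const a :: ('a, 'b) mpoly) = {}"
    "homogeneous_mpoly 0 (mpoly_const a :: ('a, 'b) mpoly)" for a
    by (fastforce simp: mpoly_vars_def homogeneous_mpoly_def monom_degree_def)+
  from this[of c] this[of 1] show ?thesis
    by (intro homogeneous_ratfunsI[where m = 0 and n = 0]) (simp_all add: mpoly_const_1)
qed

lemma subspace_homogeneous_ratfuns: "module.subspace ratfun_scale (homogeneous_ratfuns \<Psi> d)"
proof -
  interpret vector_space ratfun_scale by (rule vector_space_ratfun_scale)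
  show ?thesis
    using homogeneous_ratfuns_mult[OF ratfun_const_homogeneous, of _ \<Psi> d]
    by (intro subspaceI) (simp_all add: homogeneous_ratfuns_0 homogeneous_ratfuns_add ratfun_scale_def)
qed

section \<open>Smooth representations of the symmetric group\<close>

definition pointwise_stabilizer :: "'x set \<Rightarrow> 'x set \<Rightarrow> ('x \<Rightarrow> 'x) set" where
  "pointwise_stabilizer \<Psi> F = {g. g permutes \<Psi> \<and> (\<forall>x\<in>F. g x = x)}"

text \<open>
  The group topology on the permutations of \<open>\<Psi>\<close> for which the pointwise stabilizers of
  finite subsets form a base of neighbourhoods of the identity.
\<close>

definition sym_topology :: "'x set \<Rightarrow> ('x \<Rightarrow> 'x) topology" where
  "sym_topology \<Psi> = topology (\<lambda>U. U \<subseteq> {g. g permutes \<Psi>} \<and>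
    (\<forall>g\<in>U. \<exists>F. finite F \<and> F \<subseteq> \<Psi> \<and> (\<lambda>h. g \<circ> h) ` pointwise_stabilizer \<Psi> F \<subseteq> U))"

lemma openin_sym_topology:
  "openin (sym_topology \<Psi>) U \<longleftrightarrow> U \<subseteq> {g. g permutes \<Psi>} \<and>
    (\<forall>g\<in>U. \<exists>F. finite F \<and> F \<subseteq> \<Psi> \<and> (\<lambda>h. g \<circ> h) ` pointwise_stabilizer \<Psi> F \<subseteq> U)"
proof -
  let ?P = "\<lambda>U g F. finite F \<and> F \<subseteq> \<Psi> \<and> (\<lambda>h. g \<circ> h) ` pointwise_stabilizer \<Psi> F \<subseteq> U"
  have "istopology (\<lambda>U. U \<subseteq> {g. g permutes \<Psi>} \<and> (\<forall>g\<in>U. \<exists>F. ?P U g F))"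
    unfolding istopology_def
  proof (intro conjI allI impI)
    fix S T
    assume S: "S \<subseteq> {g. g permutes \<Psi>} \<and> (\<forall>g\<in>S. \<exists>F. ?P S g F)"
      and T: "T \<subseteq> {g. g permutes \<Psi>} \<and> (\<forall>g\<in>T. \<exists>F. ?P T g F)"
    show "S \<inter> T \<subseteq> {g. g permutes \<Psi>}" using S by blast
    show "\<forall>g\<in>S \<inter> T. \<exists>F. ?P (S \<inter> T) g F"
    proof
      fix g assume g: "g \<in> S \<inter> T"
      obtain F where F: "?P S g F" using bspec[OF conjunct2[OF S], of g] g by auto
      obtain F' where F': "?P T g F'" using bspec[OF conjunct2[OF T], of g] g by auto
      have "pointwise_stabilizer \<Psi> (F \<union> F') \<subseteq> pointwise_stabilizer \<Psi> F \<inter> pointwise_stabilizer \<Psi> F'"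
        by (auto simp: pointwise_stabilizer_def)
      with F F' have "?P (S \<inter> T) g (F \<union> F')"
        by (auto simp: image_subset_iff subset_iff)
      then show "\<exists>F. ?P (S \<inter> T) g F" by (rule exI)
    qed
  next
    fix K
    assume K: "\<forall>U\<in>K. U \<subseteq> {g. g permutes \<Psi>} \<and> (\<forall>g\<in>U. \<exists>F. ?P U g F)"
    show "\<Union>K \<subseteq> {g. g permutes \<Psi>}" using K by blast
    show "\<forall>g\<in>\<Union>K. \<exists>F. ?P (\<Union>K) g F"
    proof
      fix g assume "g \<in> \<Union>K"
      then obtain U where U: "U \<in> K" "g \<in> U" by blast
      obtain F where "?P U g F" using bspec[OF conjunct2[OF bspec[OF K U(1)]] U(2)] by (elim exE)
      then have "?P (\<Union>K) g F" using U(1) by (auto simp: image_subset_iff)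
      then show "\<exists>F. ?P (\<Union>K) g F" by (rule exI)
    qed
  qed
  then show ?thesis unfolding sym_topology_def by (simp add: topology_inverse')
qed

text \<open>
  A \<open>'k\<close>-linear representation of the group of permutations of \<open>\<Psi>\<close> on the vector
  space \<open>'v\<close>; the values \<open>\<rho> g\<close> for \<open>g\<close> not permuting \<open>\<Psi>\<close> are irrelevant.
\<close>

locale sym_representation = vector_space scale
  for scale :: "'k::field \<Rightarrow> 'v::ab_group_add \<Rightarrow> 'v" +
  fixes \<Psi> :: "'x set" and \<rho> :: "('x \<Rightarrow> 'x) \<Rightarrow> 'v \<Rightarrow> 'v"
  assumes linear_rep: "g permutes \<Psi> \<Longrightarrow> Vector_Spaces.linear scale scale (\<rho> g)"
    and rep_id: "\<rho> id v = v"
    and rep_compose: "g permutes \<Psi> \<Longrightarrow> h permutes \<Psi> \<Longrightarrow> \<rho> (g \<circ> h) v = \<rho> g (\<rho> h v)"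

definition smooth_rep :: "'x set \<Rightarrow> (('x \<Rightarrow> 'x) \<Rightarrow> 'v \<Rightarrow> 'v) \<Rightarrow> bool" where
  "smooth_rep \<Psi> \<rho> \<longleftrightarrow> (\<forall>v. openin (sym_topology \<Psi>) {g. g permutes \<Psi> \<and> \<rho> g v = v})"

definition irreducible_rep ::
  "('k::field \<Rightarrow> 'v::ab_group_add \<Rightarrow> 'v) \<Rightarrow> 'x set \<Rightarrow> (('x \<Rightarrow> 'x) \<Rightarrow> 'v \<Rightarrow> 'v) \<Rightarrow> bool" where
  "irreducible_rep scale \<Psi> \<rho> \<longleftrightarrow> (\<exists>v::'v. v \<noteq> 0) \<and>
    (\<forall>W. module.subspace scale W \<and> (\<forall>g. g permutes \<Psi> \<longrightarrow> \<rho> g ` W \<subseteq> W) \<longrightarrow> W = {0} \<or> W = UNIV)"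

end

theory Submission
  imports Defs
begin

text \<open>
  The embedding lands in the polynomials. Write \<open>G\<^sub>F\<close> for the pointwise stabilizer of a finite set
  \<open>F\<close>. A smooth irreducible representation \<open>V\<close> carries a nonzero \<open>G\<^sub>F\<close>-invariant functional \<open>l\<close> for
  some finite \<open>F\<close>. If \<open>\<Psi>\<close> is infinite and \<open>F\<close> has least possible size, then for each \<open>w\<close> in \<open>V\<close> the
  function \<open>g \<mapsto> l (g\<inverse> w)\<close>, which depends only on the restriction of \<open>g\<close> to \<open>F\<close>, has finite support;
  if \<open>\<Psi>\<close> is finite, take \<open>F = \<Psi>\<close>. With pairwise distinct exponents \<open>e a > 0\<close> the monomials
  \<open>\<Prod>a\<in>F. x\<^bsub>g a\<^esub>\<^bsup>e a\<^esup>\<close> are permuted like the restrictions of \<open>g\<close> to \<open>F\<close>, so taking the numbers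
  \<open>l (g\<inverse> w)\<close> as their coefficients gives an equivariant map to the homogeneous polynomials of degree
  \<open>\<Sum>a\<in>F. e a\<close>. It is nonzero, hence injective by irreducibility.
\<close>

section \<open>Permutations fixing a set pointwise\<close>

lemma pointwise_stabilizerI:
  "g permutes \<Psi> \<Longrightarrow> (\<And>x. x \<in> F \<Longrightarrow> g x = x) \<Longrightarrow> g \<in> pointwise_stabilizer \<Psi> F"
  by (simp add: pointwise_stabilizer_def)

lemma pointwise_stabilizerD:
  assumes "g \<in> pointwise_stabilizer \<Psi> F"
  shows "g permutes \<Psi>" "\<And>x. x \<in> F \<Longrightarrow> g x = x"
  using assms by (auto simp: pointwise_stabilizer_def)

lemma pointwise_stabilizer_mono:
  "F \<subseteq> F' \<Longrightarrow> pointwise_stabilizer \<Psi> F' \<subseteq> pointwise_stabilizer \<Psi> F"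
  by (auto simp: pointwise_stabilizer_def)

text \<open>A bijection from \<open>B\<close> to \<open>B'\<close> and one from
  \<open>B' - B\<close> to \<open>B - B'\<close> glue to a permutation of
  \<open>B \<union> B'\<close>, a set disjoint from \<open>F\<close>; elsewhere the identity is
  taken.\<close>

lemma ex_stabilizer_image_eq:
  assumes "finite B" "finite B'" "card B = card B'" "B \<subseteq> \<Psi> - F" "B' \<subseteq> \<Psi> - F"
  shows "\<exists>g \<in> pointwise_stabilizer \<Psi> F. g ` B = B'"
proof -
  have "card (B' - B) = card (B - B')"
    using assms by (simp add: card_Diff_subset_Int Int_commute)
  then obtain f where f: "bij_betw f B B'" and "bij_betw f (B' - B) (B - B')"
  proof -
    obtain f1 where f1: "bij_betw f1 B B'"
      using assms finite_same_card_bij by blast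
    obtain f2 where f2: "bij_betw f2 (B' - B) (B - B')"
      using assms \<open>card (B' - B) = card (B - B')\<close> by (meson finite_Diff finite_same_card_bij)
    define f where "f = (\<lambda>x. if x \<in> B then f1 x else f2 x)"
    have "bij_betw f B B'" using f1 by (simp add: f_def cong: bij_betw_cong)
    moreover have "bij_betw f (B' - B) (B - B')" using f2 by (subst bij_betw_cong[of _ _ f2]) (auto simp: f_def)
    ultimately show ?thesis by (rule that)
  qed
  then have "bij_betw f (B \<union> (B' - B)) (B' \<union> (B - B'))"
    by (rule bij_betw_combine) auto
  then have bij: "bij_betw f (B \<union> B') (B \<union> B')"
    by (simp add: Un_commute)
  define g where "g = (\<lambda>x. if x \<in> B \<union> B' then f x else x)"
  have "g permutes (B \<union> B')"
  proof (rule bij_imp_permutes)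
    show "bij_betw g (B \<union> B') (B \<union> B')" using bij by (subst bij_betw_cong[of _ _ f]) (auto simp: g_def)
  qed (auto simp: g_def)
  then have "g permutes \<Psi>"
    by (rule permutes_subset) (use assms in blast)
  then have "g \<in> pointwise_stabilizer \<Psi> F"
    using assms by (intro pointwise_stabilizerI) (auto simp: g_def)
  moreover have "g ` B = B'" using f by (auto simp: g_def bij_betw_def)
  ultimately show ?thesis by blast
qed

section \<open>Functionals separating a vector from a subspace\<close>

context vector_space
begin

lemma vector_space_scalars: "vector_space ((*) :: 'a \<Rightarrow> 'a \<Rightarrow> 'a)"
  by unfold_locales (simp_all add: algebra_simps)

text \<open>A basis of \<open>Y\<close> stays independent when a vector \<open>u\<close> outside
  \<open>Y\<close> is added, so a functional can be prescribed as 0 on the basis and 1 at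
  \<open>u\<close>.\<close>

lemma ex_functional_vanishing_on:
  assumes "subspace Y" "Y \<noteq> UNIV"
  shows "\<exists>l. Vector_Spaces.linear scale (*) l \<and> (\<forall>y\<in>Y. l y = 0) \<and> (\<exists>u. l u \<noteq> 0)"
proof -
  interpret vector_space_pair scale "(*)"
    by (intro vector_space_pair.intro vector_space_scalars vector_space_axioms)
  obtain u where u: "u \<notin> Y" using assms by blast
  obtain B where B: "B \<subseteq> Y" "independent B" "Y \<subseteq> span B"
    using maximal_independent_subset by blast
  have Y: "Y = span B" using B assms(1) span_minimal by blast
  have "independent (insert u B)"
    using B(2) u Y by (simp add: independent_insertI)
  from linear_independent_extend[OF this, of "\<lambda>x. if x = u then 1 else 0"]
  obtain l where l: "Vector_Spaces.linear scale (*) l" "\<And>x. x \<in> insert u B \<Longrightarrow> l x = (if x = u then 1 else 0)"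
    by blast
  have "l y = 0" if "y \<in> Y" for y
    using that unfolding Y
    by (rule linear_eq_0_on_span[OF l(1), rotated]) (use l(2) u B(1) in auto)
  moreover have "l u \<noteq> 0" using l(2) by simp
  ultimately show ?thesis using l(1) by blast
qed

end

section \<open>Supports of vectors\<close>

context sym_representation
begin

lemma
  assumes "g permutes \<Psi>"
  shows rep_add: "\<rho> g (u + v) = \<rho> g u + \<rho> g v"
    and rep_scale: "\<rho> g (scale c v) = scale c (\<rho> g v)"
    and rep_zero: "\<rho> g 0 = 0"
proof -
  interpret Vector_Spaces.linear scale scale "\<rho> g" using assms by (rule linear_rep)
  show "\<rho> g (u + v) = \<rho> g u + \<rho> g v" "\<rho> g (scale c v) = scale c (\<rho> g v)" "\<rho> g 0 = 0"
    by (simp_all add: add scale)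
qed

lemma rep_inv_rep: "g permutes \<Psi> \<Longrightarrow> \<rho> (inv g) (\<rho> g v) = v"
  by (metis permutes_inv permutes_inv_o(2) rep_compose rep_id)

lemma rep_rep_inv: "g permutes \<Psi> \<Longrightarrow> \<rho> g (\<rho> (inv g) v) = v"
  by (metis permutes_inv permutes_inv_o(1) rep_compose rep_id)

lemma rep_span_image:
  assumes "g permutes \<Psi>" "u \<in> span S" "\<And>s. s \<in> S \<Longrightarrow> \<rho> g s \<in> span S'"
  shows "\<rho> g u \<in> span S'"
  using assms(2)
proof (induction rule: span_induct_alt)
  case base
  then show ?case using assms(1) by (simp add: rep_zero span_zero)
next
  case (step c x y)
  then show ?case using assms(1,3) by (simp add: rep_add rep_scale span_add span_scale)
qed

text \<open>Support in the sense of nominal sets; neither finiteness nor minimality of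
  \<open>C\<close> is built in.\<close>

definition supports :: "'x set \<Rightarrow> 'v \<Rightarrow> bool" where
  "supports C v \<longleftrightarrow> (\<forall>h \<in> pointwise_stabilizer \<Psi> C. \<rho> h v = v)"

lemma supports_mono: "C \<subseteq> C' \<Longrightarrow> supports C v \<Longrightarrow> supports C' v"
  using pointwise_stabilizer_mono by (fastforce simp: supports_def)

text \<open>The permutation \<open>inv h \<circ> g\<close> fixes \<open>C\<close> pointwise.
  Translates of \<open>v\<close> are thus determined by maps on \<open>C\<close>, which is the
  source of finiteness later.\<close>

lemma rep_eq_if_eq_on_support:
  assumes "supports C v" "g permutes \<Psi>" "h permutes \<Psi>" "\<And>x. x \<in> C \<Longrightarrow> g x = h x"
  shows "\<rho> g v = \<rho> h v"
proof -
  have "inv h \<circ> g \<in> pointwise_stabilizer \<Psi> C"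
    using assms by (intro pointwise_stabilizerI permutes_compose permutes_inv)
      (auto simp: permutes_inverses)
  then have "\<rho> (inv h \<circ> g) v = v" using assms(1) by (simp add: supports_def)
  then show ?thesis using assms(2,3) by (metis permutes_inv rep_compose rep_rep_inv)
qed

lemma supports_rep:
  assumes "supports C v" "g permutes \<Psi>"
  shows "supports (g ` C) (\<rho> g v)"
  unfolding supports_def
proof
  fix h assume h: "h \<in> pointwise_stabilizer \<Psi> (g ` C)"
  have "\<rho> (h \<circ> g) v = \<rho> g v"
    using assms h by (intro rep_eq_if_eq_on_support[OF assms(1)] permutes_compose)
      (auto dest: pointwise_stabilizerD)
  then show "\<rho> h (\<rho> g v) = \<rho> g v"
    using assms(2) h by (simp add: rep_compose pointwise_stabilizerD)
qed

text \<open>The open stabilizer of \<open>v\<close> contains a basic neighbourhood of the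
  identity.\<close>

lemma smooth_imp_supports:
  assumes "smooth_rep \<Psi> \<rho>"
  shows "\<exists>C. finite C \<and> C \<subseteq> \<Psi> \<and> supports C v"
proof -
  have "openin (sym_topology \<Psi>) {g. g permutes \<Psi> \<and> \<rho> g v = v}"
    using assms by (simp add: smooth_rep_def)
  moreover have "id \<in> {g. g permutes \<Psi> \<and> \<rho> g v = v}"
    by (simp add: rep_id permutes_id)
  ultimately obtain C where "finite C" "C \<subseteq> \<Psi>"
    "(\<lambda>h. id \<circ> h) ` pointwise_stabilizer \<Psi> C \<subseteq> {g. g permutes \<Psi> \<and> \<rho> g v = v}"
    unfolding openin_sym_topology by blast
  then show ?thesis unfolding supports_def by auto
qed

lemma irreducible_repD:
  assumes "irreducible_rep scale \<Psi> \<rho>" "subspace W"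
    "\<And>g v. g permutes \<Psi> \<Longrightarrow> v \<in> W \<Longrightarrow> \<rho> g v \<in> W"
  shows "W = {0} \<or> W = UNIV"
  using assms unfolding irreducible_rep_def by (meson image_subsetI)

lemma span_orbit_eq_UNIV:
  assumes "irreducible_rep scale \<Psi> \<rho>" "v \<noteq> 0"
  shows "span {\<rho> g v |g. g permutes \<Psi>} = UNIV" (is "?W = _")
proof -
  have "\<rho> h u \<in> ?W" if "h permutes \<Psi>" "u \<in> ?W" for h u
    using that
    by (rule rep_span_image) (use that(1) in \<open>auto intro!: span_base simp flip: rep_compose intro: permutes_compose\<close>)
  then have "?W = {0} \<or> ?W = UNIV"
    using irreducible_repD[OF assms(1) subspace_span] by blast
  moreover have "\<rho> id v \<in> ?W" using permutes_id by (intro span_base) blast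
  ultimately show ?thesis using assms(2) by (auto simp: rep_id)
qed

section \<open>Functionals invariant under a pointwise stabilizer\<close>

text \<open>By Frobenius reciprocity such an \<open>l\<close> amounts to an equivariant map from the
  representation to functions on the cosets of the stabilizer of \<open>F\<close>, sending
  \<open>w\<close> to the function with value \<open>l (\<rho> (inv g) w)\<close> at the coset of
  \<open>g\<close>.\<close>

definition invariant_functional :: "'x set \<Rightarrow> ('v \<Rightarrow> 'k) \<Rightarrow> bool" where
  "invariant_functional F l \<longleftrightarrow> Vector_Spaces.linear scale (*) l \<and>
    (\<forall>h \<in> pointwise_stabilizer \<Psi> F. \<forall>v. l (\<rho> h v) = l v)"

lemma
  assumes "invariant_functional F l"
  shows invariant_functional_add: "l (u + v) = l u + l v"
    and invariant_functional_scale: "l (scale c v) = c * l v"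
proof -
  interpret Vector_Spaces.linear scale "(*)" l
    using assms by (simp add: invariant_functional_def)
  show "l (u + v) = l u + l v" "l (scale c v) = c * l v"
    by (simp_all add: add scale)
qed

text \<open>The stabilizer acts on the left of \<open>g\<close>, so inverses have to agree on
  \<open>F\<close>: this says that \<open>h \<circ> inv g\<close> fixes \<open>F\<close>
  pointwise.\<close>

lemma invariant_functional_eq:
  assumes "invariant_functional F l" "g permutes \<Psi>" "h permutes \<Psi>"
    "\<And>x. x \<in> F \<Longrightarrow> inv g x = inv h x"
  shows "l (\<rho> g v) = l (\<rho> h v)"
proof -
  have "h \<circ> inv g \<in> pointwise_stabilizer \<Psi> F"
    using assms by (intro pointwise_stabilizerI permutes_compose permutes_inv)
      (auto simp: permutes_inverses)
  then have "l (\<rho> (h \<circ> inv g) (\<rho> g v)) = l (\<rho> g v)"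
    using assms(1) by (simp add: invariant_functional_def)
  then show ?thesis using assms(2,3) by (simp add: rep_compose permutes_inv rep_inv_rep)
qed

text \<open>
  For \<open>v\<close> supported on \<open>A\<close>, let \<open>m\<close> be the least number such that, for some finite \<open>F\<close>, the
  translates \<open>g v\<close> with at most \<open>m\<close> points of \<open>g A\<close> outside \<open>F\<close> span. Fix \<open>B = g A - F\<close> of size \<open>m\<close>
  and drop the translates with \<open>g A - F = B\<close>. If the others still spanned, then adjoining to \<open>F\<close>
  the finitely many points needed to express the dropped vectors would contradict the minimality
  of \<open>m\<close>. Modulo the span of the others, the stabilizer of \<open>F \<union> B\<close> acts trivially.
\<close>

lemma ex_invariant_functional:
  assumes smooth: "smooth_rep \<Psi> \<rho>" and irr: "irreducible_rep scale \<Psi> \<rho>"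
  shows "\<exists>F l. finite F \<and> F \<subseteq> \<Psi> \<and> invariant_functional F l \<and> (\<exists>v. l v \<noteq> 0)"
proof -
  obtain v :: 'v where v: "v \<noteq> 0" using irr by (auto simp: irreducible_rep_def)
  obtain A where A: "finite A" "A \<subseteq> \<Psi>" "supports A v"
    using smooth_imp_supports[OF smooth] by blast
  define T where "T F m = {\<rho> g v |g. g permutes \<Psi> \<and> card (g ` A - F) \<le> m}" for F m
  define spans where "spans m \<longleftrightarrow> (\<exists>F. finite F \<and> F \<subseteq> \<Psi> \<and> span (T F m) = UNIV)" for m
  have gA: "finite (g ` A)" "g permutes \<Psi> \<Longrightarrow> g ` A \<subseteq> \<Psi>" for g
    using A by (auto simp: permutes_in_image)
  have "T {} (card A) = {\<rho> g v |g. g permutes \<Psi>}"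
    using A(1) by (auto simp: T_def card_image_le)
  then have "spans (card A)"
    using span_orbit_eq_UNIV[OF irr v] unfolding spans_def by (intro exI[of _ "{}"]) simp
  define m where "m = (LEAST m. spans m)"
  have "spans m" unfolding m_def using \<open>spans (card A)\<close> by (rule LeastI)
  have m_min: "\<not> spans m'" if "m' < m" for m'
    using that unfolding m_def by (rule not_less_Least)
  obtain F where F: "finite F" "F \<subseteq> \<Psi>" "span (T F m) = UNIV"
    using \<open>spans m\<close> by (auto simp: spans_def)
  \<comment> \<open>The strict bound covers \<open>m = 0\<close> as well: there \<open>T' H\<close>
    is empty, and otherwise it is \<open>T H (m - 1)\<close>.\<close>
  define T' where "T' H = {\<rho> g v |g. g permutes \<Psi> \<and> card (g ` A - H) < m}" for H
  have T'_proper: "span (T' H) \<noteq> UNIV" if H: "finite H" "H \<subseteq> \<Psi>" for H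
  proof (cases m)
    case 0
    then have "T' H = {}" by (simp add: T'_def)
    then show ?thesis using v by auto
  next
    case (Suc n)
    then have "T' H = T H n" by (auto simp: T'_def T_def less_Suc_eq_le)
    then show ?thesis using m_min[of n] H Suc by (auto simp: spans_def)
  qed
  obtain g0 where g0: "g0 permutes \<Psi>" "card (g0 ` A - F) = m"
  proof (rule ccontr)
    assume "\<not> thesis"
    then have "T F m \<subseteq> T' F" using that by (force simp: T_def T'_def le_less)
    then have "span (T' F) = UNIV" using span_mono F(3) by blast
    then show False using T'_proper F by blast
  qed
  define B where "B = g0 ` A - F"
  have B: "finite B" "card B = m" "B \<subseteq> \<Psi> - F" "B \<inter> F = {}"
    using g0 gA(2)[of g0] A(1) by (auto simp: B_def)
  define S where "S = {\<rho> g v |g. g permutes \<Psi> \<and> card (g ` A - F) \<le> m \<and> g ` A - F \<noteq> B}"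
  have "span S \<noteq> UNIV"
  proof
    assume full: "span S = UNIV"
    define U where "U = {\<rho> g v |g. g permutes \<Psi> \<and> g ` A - F = B}"
    \<comment> \<open>An element \<open>\<rho> g v\<close> of \<open>U\<close> depends only on
      \<open>g\<close> restricted to \<open>A\<close>, and this restriction has values in the finite
      set \<open>F \<union> B\<close>.\<close>
    have "finite U"
    proof (rule finite_surj)
      show "finite (A \<rightarrow>\<^sub>E F \<union> B)" using A(1) F(1) B(1) by (intro finite_PiE) auto
      show "U \<subseteq> (\<lambda>f. \<rho> (SOME g. g permutes \<Psi> \<and> (\<forall>a\<in>A. g a = f a)) v) ` (A \<rightarrow>\<^sub>E F \<union> B)"
      proof
        fix u assume "u \<in> U"
        then obtain g where g: "u = \<rho> g v" "g permutes \<Psi>" "g ` A - F = B"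
          by (auto simp: U_def)
        define h where "h = (SOME h. h permutes \<Psi> \<and> (\<forall>a\<in>A. h a = restrict g A a))"
        have "h permutes \<Psi> \<and> (\<forall>a\<in>A. h a = restrict g A a)"
          unfolding h_def by (rule someI[of _ g]) (use g in simp)
        then have "u = \<rho> h v"
          using g by (auto intro: rep_eq_if_eq_on_support[OF A(3)])
        moreover have "restrict g A \<in> A \<rightarrow>\<^sub>E F \<union> B" using g(3) by auto
        ultimately show "u \<in> (\<lambda>f. \<rho> (SOME g. g permutes \<Psi> \<and> (\<forall>a\<in>A. g a = f a)) v) ` (A \<rightarrow>\<^sub>E F \<union> B)"
          unfolding h_def by blast
      qed
    qed
    have "\<exists>s. finite s \<and> s \<subseteq> S \<and> u \<in> span s" for u
    proof -
      have "u \<in> span S" using full by simp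
      then obtain t r where t: "finite t" "t \<subseteq> S" "u = (\<Sum>a\<in>t. scale (r a) a)"
        unfolding span_explicit by blast
      have "u \<in> span t" unfolding t(3) by (intro span_sum span_scale span_base)
      then show ?thesis using t by blast
    qed
    then obtain s where s: "\<And>u. finite (s u)" "\<And>u. s u \<subseteq> S" "\<And>u. u \<in> span (s u)"
      by metis
    define S0 where "S0 = (\<Union>u\<in>U. s u)"
    have S0: "finite S0" "S0 \<subseteq> S"
      using s(1,2) \<open>finite U\<close> by (auto simp: S0_def)
    have "s u \<subseteq> S0" if "u \<in> U" for u using that by (auto simp: S0_def)
    then have "U \<subseteq> span S0" using s(3) span_mono by blast
    have "\<forall>w\<in>S0. \<exists>g. w = \<rho> g v \<and> g permutes \<Psi> \<and> card (g ` A - F) \<le> m \<and> g ` A - F \<noteq> B"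
      using S0(2) by (auto simp: S_def)
    then obtain p where p: "\<And>w. w \<in> S0 \<Longrightarrow> w = \<rho> (p w) v \<and> p w permutes \<Psi> \<and>
        card (p w ` A - F) \<le> m \<and> p w ` A - F \<noteq> B" by metis
    \<comment> \<open>Removing \<open>B\<close> keeps \<open>H\<close> disjoint from it. For
      \<open>w\<close> in \<open>S0\<close> the points outside \<open>H\<close> then lie in
      \<open>B\<close>; if there were \<open>m\<close> of them, \<open>p w\<close> would map
      \<open>A\<close> onto exactly \<open>B\<close> outside \<open>F\<close>, which
      \<open>S\<close> excludes.\<close>
    define H where "H = F \<union> ((\<Union>w\<in>S0. p w ` A) - B)"
    have "(\<Union>w\<in>S0. p w ` A) \<subseteq> \<Psi>" using p gA(2) by blast
    then have H: "finite H" "H \<subseteq> \<Psi>" "F \<subseteq> H" "B \<inter> H = {}"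
      using F S0(1) A(1) B(4) by (auto simp: H_def)
    have card_less: "card (g ` A - H) < m"
      if "card (g ` A - F) \<le> m" "g ` A - H \<noteq> g ` A - F" for g
    proof -
      have "g ` A - H \<subset> g ` A - F" using that(2) H(3) by blast
      then have "card (g ` A - H) < card (g ` A - F)" using A(1) by (intro psubset_card_mono) auto
      then show ?thesis using that(1) by simp
    qed
    have "S0 \<subseteq> T' H"
    proof
      fix w assume w: "w \<in> S0"
      have sub: "p w ` A - H \<subseteq> B" "p w ` A - H \<subseteq> p w ` A - F" using w by (auto simp: H_def)
      have "card (p w ` A - H) < m"
      proof (rule ccontr)
        assume ge: "\<not> card (p w ` A - H) < m"
        then have "p w ` A - H = B" using sub(1) B(1,2) by (intro card_seteq) auto
        moreover have "p w ` A - H = p w ` A - F"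
          using ge card_less p[OF w] by blast
        ultimately show False using p[OF w] by simp
      qed
      then show "w \<in> T' H" using p[OF w] by (auto simp: T'_def)
    qed
    then have U: "U \<subseteq> span (T' H)" using \<open>U \<subseteq> span S0\<close> span_mono by blast
    have "T F m \<subseteq> span (T' H)"
    proof
      fix w assume "w \<in> T F m"
      then obtain g where g: "w = \<rho> g v" "g permutes \<Psi>" "card (g ` A - F) \<le> m"
        by (auto simp: T_def)
      show "w \<in> span (T' H)"
      proof (cases "card (g ` A - H) < m")
        case True
        then show ?thesis using g by (intro span_base) (auto simp: T'_def)
      next
        case False
        \<comment> \<open>The outer part of the image of \<open>A\<close> has \<open>m\<close>
          points, none in \<open>H\<close>, so some \<open>h\<close> fixing \<open>H\<close> carries
          \<open>B\<close> onto it. Undoing \<open>h\<close> brings \<open>w\<close> into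
          \<open>U\<close>, and \<open>h\<close> preserves the span of \<open>T' H\<close>.\<close>
        then have eq: "g ` A - H = g ` A - F" using card_less g(3) by blast
        then have "card (g ` A - F) = m" using False g(3) by simp
        moreover have "g ` A - F \<subseteq> \<Psi> - H" using gA(2)[OF g(2)] eq by blast
        moreover have "B \<subseteq> \<Psi> - H" using B(3) H(4) by blast
        ultimately obtain h where h: "h \<in> pointwise_stabilizer \<Psi> H" "h ` B = g ` A - F"
          using ex_stabilizer_image_eq[of B "g ` A - F" \<Psi> H] B(1,2) A(1) by auto
        have hp: "h permutes \<Psi>" "bij h" using pointwise_stabilizerD(1)[OF h(1)] by (auto simp: permutes_bij)
        have hF: "inv h ` F = F"
        proof -
          have "inv h x = x" if "x \<in> F" for x
            using that H(3) pointwise_stabilizerD[OF h(1)] by (metis permutes_inverses(2) subsetD)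
          then show ?thesis by simp
        qed
        have "(inv h \<circ> g) ` A - F = inv h ` (g ` A) - inv h ` F"
          by (simp add: hF image_comp)
        also have "\<dots> = inv h ` (g ` A - F)"
          using hp by (simp add: image_set_diff bij_is_inj bij_imp_bij_inv)
        also have "\<dots> = B"
          unfolding h(2)[symmetric] using hp by (simp add: image_comp bij_is_inj)
        finally have "\<rho> (inv h \<circ> g) v \<in> U"
          using hp(1) g(2) by (auto simp: U_def intro!: exI[of _ "inv h \<circ> g"] permutes_compose permutes_inv)
        then have "\<rho> (inv h \<circ> g) v \<in> span (T' H)" using U by blast
        then have "\<rho> h (\<rho> (inv h \<circ> g) v) \<in> span (T' H)"
        proof (rule rep_span_image[OF hp(1)])
          fix t assume "t \<in> T' H"
          then obtain f where f: "t = \<rho> f v" "f permutes \<Psi>" "card (f ` A - H) < m"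
            by (auto simp: T'_def)
          have "h ` H = H" using pointwise_stabilizerD(2)[OF h(1)] by simp
          then have "(h \<circ> f) ` A - H = h ` (f ` A - H)"
            using hp by (simp add: image_set_diff bij_is_inj image_comp)
          then have "card ((h \<circ> f) ` A - H) < m"
            using f(3) A(1) by (metis card_image_le finite_Diff finite_imageI le_less_trans)
          then show "\<rho> h t \<in> span (T' H)"
            using f hp(1) by (intro span_base)
              (auto simp: T'_def rep_compose[symmetric] intro!: exI[of _ "h \<circ> f"] permutes_compose)
        qed
        then show ?thesis
          using hp(1) g by (simp add: rep_compose permutes_inv rep_rep_inv)
      qed
    qed
    then have "span (T' H) = UNIV"
      using F(3) by (metis span_minimal subspace_span top.extremum_uniqueI)
    then show False using T'_proper H by blast
  qed
  then obtain l where l: "Vector_Spaces.linear scale (*) l" "\<And>y. y \<in> span S \<Longrightarrow> l y = 0" "\<exists>u. l u \<noteq> 0"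
    using ex_functional_vanishing_on[OF subspace_span] by blast
  interpret l: Vector_Spaces.linear scale "(*)" l by (rule l(1))
  \<comment> \<open>A spanning translate with outer part \<open>B\<close> is supported on
    \<open>F \<union> B\<close>, so \<open>h\<close> fixes it. Any other one lies in
    \<open>S\<close>, which \<open>h\<close> maps into itself and on which \<open>l\<close>
    vanishes.\<close>
  have "l (\<rho> h u) = l u" if h: "h \<in> pointwise_stabilizer \<Psi> (F \<union> B)" for h u
  proof -
    have hp: "h permutes \<Psi>" "inj h" using pointwise_stabilizerD(1)[OF h] by (auto simp: permutes_inj)
    have hFB: "h ` F = F" "h ` B = B" using pointwise_stabilizerD(2)[OF h] by auto
    have "u \<in> span (T F m)" using F(3) by simp
    then show ?thesis
    proof (induction rule: span_induct_alt)
      case base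
      then show ?case using hp by (simp add: rep_zero)
    next
      case (step c x y)
      from step(1) obtain g where g: "x = \<rho> g v" "g permutes \<Psi>" "card (g ` A - F) \<le> m"
        by (auto simp: T_def)
      have "l (\<rho> h x) = l x"
      proof (cases "g ` A - F = B")
        case True
        then have "g ` A \<subseteq> F \<union> B" by blast
        then have "supports (F \<union> B) x"
          unfolding g(1) using supports_rep[OF A(3) g(2)] supports_mono by blast
        then show ?thesis using h by (simp add: supports_def)
      next
        case False
        then have "x \<in> S" using g by (auto simp: S_def)
        have eq: "(h \<circ> g) ` A - F = h ` (g ` A - F)"
          using hp hFB by (simp add: image_set_diff image_comp)
        then have "(h \<circ> g) ` A - F \<noteq> B"
          using False hFB hp(2) by (metis inj_image_eq_iff)
        moreover have "card ((h \<circ> g) ` A - F) \<le> m"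
          using g(3) A(1) eq by (metis card_image_le finite_Diff finite_imageI le_trans)
        ultimately have "\<rho> h x \<in> S"
          using g hp(1) by (auto simp: S_def rep_compose[symmetric] intro!: exI[of _ "h \<circ> g"] permutes_compose)
        then show ?thesis using \<open>x \<in> S\<close> l(2) by (simp add: span_base)
      qed
      then show ?case using step hp(1) by (simp add: rep_add rep_scale l.add l.scale)
    qed
  qed
  then have "invariant_functional (F \<union> B) l"
    using l(1) by (simp add: invariant_functional_def)
  then show ?thesis using l(3) F B by (intro exI[of _ "F \<union> B"]) blast
qed

text \<open>
  If some \<open>x \<in> F\<close> is moved by \<open>g\<close> out of the support of \<open>w\<close>, then \<open>l (g\<inverse> w)\<close> is the limit, for \<open>y\<close>
  outside of growing finite sets, of \<open>l\<close> with \<open>x\<close> replaced by \<open>y\<close>. This limit is a functional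
  invariant under the stabilizer of \<open>F - {x}\<close>, hence vanishes by minimality of \<open>F\<close>.
\<close>

lemma minimal_invariant_functional_support:
  assumes smooth: "smooth_rep \<Psi> \<rho>" and inf: "infinite \<Psi>"
    and F: "finite F" "F \<subseteq> \<Psi>" and l: "invariant_functional F l"
    and minimal: "\<And>F' l' v. finite F' \<Longrightarrow> F' \<subseteq> \<Psi> \<Longrightarrow> invariant_functional F' l' \<Longrightarrow> l' v \<noteq> 0 \<Longrightarrow>
      card F \<le> card F'"
    and C: "finite C" "supports C w"
    and g: "g permutes \<Psi>" "l (\<rho> (inv g) w) \<noteq> 0"
  shows "g ` F \<subseteq> C"
proof (rule ccontr)
  assume "\<not> g ` F \<subseteq> C"
  then obtain x where x: "x \<in> F" "g x \<notin> C" by blast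
  have xP: "x \<in> \<Psi>" using x F by blast
  define l' where "l' y u = l (\<rho> (transpose x y) u)" for y u
  \<comment> \<open>The value taken by \<open>l' y u\<close> for all but finitely many
    \<open>y\<close>. It exists by \<open>const\<close> and is unique because \<open>\<Psi>\<close>
    is infinite.\<close>
  define \<mu> where "\<mu> u = (THE c. finite {y \<in> \<Psi>. l' y u \<noteq> c})" for u
  have perm: "transpose a b permutes \<Psi>" if "a \<in> \<Psi>" "b \<in> \<Psi>" for a b
    using that by (rule permutes_swap_id)
  \<comment> \<open>Swapping \<open>y\<close> and \<open>y'\<close> fixes \<open>u\<close>, and the
    two permutations compared have inverses that agree on \<open>F\<close>. The value
    \<open>y = x\<close> is deliberately allowed; it is used at the end.\<close>
  have const: "l' y u = l' y' u"
    if D: "supports D u" and y: "y \<in> \<Psi> - (D \<union> (F - {x}))" "y' \<in> \<Psi> - (D \<union> (F - {x}))" for D u y y'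
  proof -
    have "transpose y y' \<in> pointwise_stabilizer \<Psi> D"
      using y by (intro pointwise_stabilizerI perm) (auto simp: transpose_def)
    then have "l' y' u = l (\<rho> (transpose x y' \<circ> transpose y y') u)"
      using D y xP by (simp add: l'_def rep_compose perm supports_def)
    moreover have "l (\<rho> (transpose x y) u) = l (\<rho> (transpose x y' \<circ> transpose y y') u)"
      using y xP by (intro invariant_functional_eq[OF l] permutes_compose perm)
        (auto simp: o_inv_distrib transpose_def)
    ultimately show ?thesis by (simp add: l'_def)
  qed
  have outside: "\<exists>y. y \<in> \<Psi> - D" if "finite D" for D
    using Diff_infinite_finite[OF that inf] by (metis ex_in_conv finite.emptyI)
  have \<mu>: "\<mu> u = l' y u" if D: "finite D" "supports D u" and y: "y \<in> \<Psi> - (D \<union> (F - {x}))" for D u y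
    unfolding \<mu>_def
  proof (rule the_equality)
    have "{y' \<in> \<Psi>. l' y' u \<noteq> l' y u} \<subseteq> D \<union> (F - {x})"
      using const[OF D(2) _ y] by blast
    then show "finite {y' \<in> \<Psi>. l' y' u \<noteq> l' y u}"
      using D(1) F(1) by (meson finite_Diff finite_Un finite_subset)
  next
    fix c assume "finite {y' \<in> \<Psi>. l' y' u \<noteq> c}"
    then obtain y' where "y' \<in> \<Psi> - ({y' \<in> \<Psi>. l' y' u \<noteq> c} \<union> (D \<union> (F - {x})))"
      using outside[of "{y' \<in> \<Psi>. l' y' u \<noteq> c} \<union> (D \<union> (F - {x}))"] D(1) F(1) by auto
    then show "c = l' y u" using const[OF D(2) _ y, of y'] by auto
  qed
  have "\<mu> (u + v) = \<mu> u + \<mu> v" for u v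
  proof -
    obtain D where D: "finite D" "supports D u" using smooth_imp_supports[OF smooth] by blast
    obtain E where E: "finite E" "supports E v" using smooth_imp_supports[OF smooth] by blast
    have DE: "supports (D \<union> E) u" "supports (D \<union> E) v"
      using D E supports_mono by blast+
    then have "supports (D \<union> E) (u + v)"
      by (simp add: supports_def rep_add pointwise_stabilizerD(1))
    moreover obtain y where "y \<in> \<Psi> - (D \<union> E \<union> (F - {x}))"
      using outside[of "D \<union> E \<union> (F - {x})"] D E F by auto
    ultimately show ?thesis
      using \<mu>[of "D \<union> E" _ y] DE D(1) E(1) xP
      by (simp add: l'_def rep_add perm invariant_functional_add[OF l])
  qed
  moreover have "\<mu> (scale c u) = c * \<mu> u" for c u
  proof -
    obtain D where D: "finite D" "supports D u" using smooth_imp_supports[OF smooth] by blast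
    then have "supports D (scale c u)"
      by (simp add: supports_def rep_scale pointwise_stabilizerD(1))
    moreover obtain y where "y \<in> \<Psi> - (D \<union> (F - {x}))"
      using outside[of "D \<union> (F - {x})"] D F by auto
    ultimately show ?thesis
      using \<mu>[of D _ y] D xP by (simp add: l'_def rep_scale perm invariant_functional_scale[OF l])
  qed
  moreover have "\<mu> (\<rho> h u) = \<mu> u" if h: "h \<in> pointwise_stabilizer \<Psi> (F - {x})" for h u
  proof -
    have hp: "h permutes \<Psi>" "bij h" using pointwise_stabilizerD(1)[OF h] by (auto simp: permutes_bij)
    have hF: "inv h z = z" if "z \<in> F" "z \<noteq> x" for z
      using that pointwise_stabilizerD[OF h] by (metis Diff_iff permutes_inverses(2) singletonD)
    obtain D where D: "finite D" "supports D u" using smooth_imp_supports[OF smooth] by blast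
    obtain y where y: "y \<in> \<Psi> - (h ` D \<union> F \<union> h ` F)"
      using outside[of "h ` D \<union> F \<union> h ` F"] D F by auto
    have y': "inv h y \<in> \<Psi> - (D \<union> F)"
      using y hp by (auto simp: permutes_in_image permutes_inv permutes_inverses image_iff)
    \<comment> \<open>Both inverses send \<open>x\<close> to \<open>inv h y\<close> and fix the rest
      of \<open>F\<close>. Hence applying \<open>h\<close> to \<open>u\<close> only renames the
      generic point \<open>y\<close>.\<close>
    have "l (\<rho> (transpose x y \<circ> h) u) = l (\<rho> (transpose x (inv h y)) u)"
      using y y' xP hp hF
      by (intro invariant_functional_eq[OF l] permutes_compose perm)
        (auto simp: o_inv_distrib transpose_def)
    then have "l' y (\<rho> h u) = l' (inv h y) u"
      using y xP hp by (simp add: l'_def rep_compose perm)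
    moreover have "\<mu> (\<rho> h u) = l' y (\<rho> h u)"
      using y D supports_rep[OF D(2) hp(1)] by (intro \<mu>[of "h ` D"]) auto
    moreover have "\<mu> u = l' (inv h y) u"
      using y' D by (intro \<mu>[of D]) auto
    ultimately show ?thesis by simp
  qed
  ultimately have "invariant_functional (F - {x}) \<mu>"
    unfolding invariant_functional_def Vector_Spaces.linear_iff
    using vector_space_axioms vector_space_scalars by blast
  moreover have "\<not> card F \<le> card (F - {x})"
    using card_Diff1_less[OF F(1) x(1)] by simp
  ultimately have "\<mu> u = 0" for u
    using minimal[of "F - {x}" \<mu> u] F by blast
  \<comment> \<open>As \<open>g x\<close> is outside \<open>C\<close>, the point \<open>x\<close>
    itself is generic for this vector; \<open>transpose x x\<close> is the identity, so the limit is
    \<open>l (\<rho> (inv g) w)\<close>.\<close>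
  moreover have "\<mu> (\<rho> (inv g) w) = l' x (\<rho> (inv g) w)"
  proof (rule \<mu>)
    show "supports (inv g ` C) (\<rho> (inv g) w)" "finite (inv g ` C)"
      using C g(1) by (auto intro: supports_rep permutes_inv)
    show "x \<in> \<Psi> - (inv g ` C \<union> (F - {x}))"
      using xP x(2) g(1) by (auto simp: permutes_inverses)
  qed
  ultimately show False using g(2) by (simp add: l'_def rep_id)
qed

end

section \<open>The embedding into homogeneous polynomials\<close>

lemma monom_degree_single: "monom_degree (Poly_Mapping.single x n) = n"
  by (simp add: monom_degree_def)

lemma monom_degree_sum: "monom_degree (sum f A) = (\<Sum>a\<in>A. monom_degree (f a))"
  by (induction A rule: infinite_finite_induct) (simp_all add: monom_degree_add monom_degree_def[of 0])

context sym_representation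
begin

text \<open>The assumption \<open>fin\<close> leaves only finitely many nonzero coefficients, so
  that they form a polynomial; finite and infinite \<open>\<Psi>\<close> both reduce to
  this.\<close>

lemma embeds_if_finitely_supported:
  assumes irr: "irreducible_rep scale \<Psi> \<rho>"
    and F: "finite F" "F \<subseteq> \<Psi>" and l: "invariant_functional F l" "l v0 \<noteq> 0"
    and fin: "\<And>w. \<exists>C. finite C \<and> (\<forall>g. g permutes \<Psi> \<longrightarrow> l (\<rho> (inv g) w) \<noteq> 0 \<longrightarrow> g ` F \<subseteq> C)"
  shows "\<exists>(d::int) (\<phi> :: 'v \<Rightarrow> ('x, 'k) ratfun).
    Vector_Spaces.linear scale ratfun_scale \<phi> \<and> inj \<phi> \<and>
    range \<phi> \<subseteq> homogeneous_ratfuns \<Psi> d \<and>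
    (\<forall>g v. g permutes \<Psi> \<longrightarrow> \<phi> (\<rho> g v) = ratfun_act g (\<phi> v))"
proof -
  obtain e0 :: "'x \<Rightarrow> nat" where e0: "inj_on e0 F"
    using finite_imp_inj_to_nat_seg[OF F(1)] by metis
  \<comment> \<open>With \<open>Suc\<close> every variable \<open>g a\<close> really occurs in
    \<open>mono g\<close>; its exponent then identifies \<open>a\<close>, so \<open>mono g\<close>
    determines \<open>g\<close> on \<open>F\<close>.\<close>
  define e where "e a = Suc (e0 a)" for a
  define mono :: "('x \<Rightarrow> 'x) \<Rightarrow> 'x \<Rightarrow>\<^sub>0 nat"
    where "mono g = (\<Sum>a\<in>F. Poly_Mapping.single (g a) (e a))" for g
  have lookup_mono: "Poly_Mapping.lookup (mono g) y = (\<Sum>a\<in>F. if g a = y then e a else 0)" for g y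
    by (simp add: mono_def lookup_sum lookup_single when_def)
  have lookup_mono_image: "Poly_Mapping.lookup (mono g) (g a) = e a" if "g permutes \<Psi>" "a \<in> F" for g a
    using that F(1) by (simp add: lookup_mono inj_eq[OF permutes_inj])
  have mono_eqD: "g a = h a"
    if "mono g = mono h" "g permutes \<Psi>" "h permutes \<Psi>" "a \<in> F" for g h a
  proof -
    have "Poly_Mapping.lookup (mono h) (g a) = e a"
      using lookup_mono_image[OF that(2,4)] that(1) by simp
    then have "(\<Sum>b\<in>F. if h b = g a then e b else 0) \<noteq> 0"
      by (simp add: lookup_mono e_def)
    then obtain b where b: "b \<in> F" "h b = g a"
      by (rule sum.not_neutral_contains_not_neutral) (auto split: if_splits)
    then have "e b = e a"
      using lookup_mono_image[OF that(3) b(1)] \<open>Poly_Mapping.lookup (mono h) (g a) = e a\<close> by simp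
    then have "a = b" using e0 b(1) that(4) by (auto simp: e_def dest: inj_onD)
    then show ?thesis using b by simp
  qed
  have map_key_mono: "Poly_Mapping.map_key h (mono g) = mono (inv h \<circ> g)" if "h permutes \<Psi>" for g h
  proof (rule poly_mapping_eqI)
    fix y
    have "g a = h y \<longleftrightarrow> inv h (g a) = y" for a
      using that by (metis permutes_inverses)
    then show "Poly_Mapping.lookup (Poly_Mapping.map_key h (mono g)) y = Poly_Mapping.lookup (mono (inv h \<circ> g)) y"
      using that by (simp add: lookup_map_key permutes_inj lookup_mono)
  qed
  \<comment> \<open>The choice is harmless: all \<open>g\<close> with the same monomial agree on
    \<open>F\<close>, and \<open>l (\<rho> (inv g) w)\<close> depends on nothing else.\<close>
  define coef where "coef w m =
    (if \<exists>g. g permutes \<Psi> \<and> m = mono g then l (\<rho> (inv (SOME g. g permutes \<Psi> \<and> m = mono g)) w) else 0)"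
    for w m
  have coef_mono: "coef w (mono g) = l (\<rho> (inv g) w)" if g: "g permutes \<Psi>" for w g
  proof -
    define h where "h = (SOME h. h permutes \<Psi> \<and> mono g = mono h)"
    have h: "h permutes \<Psi> \<and> mono g = mono h"
      unfolding h_def by (rule someI[of _ g]) (use g in simp)
    have "l (\<rho> (inv h) w) = l (\<rho> (inv g) w)"
      using g h mono_eqD[of g h] by (intro invariant_functional_eq[OF l(1)])
        (auto simp: permutes_inv permutes_inv_inv)
    then show ?thesis using g unfolding coef_def h_def by auto
  qed
  have coef_other: "coef w m = 0" if "\<And>g. g permutes \<Psi> \<Longrightarrow> m \<noteq> mono g" for w m
    using that by (auto simp: coef_def)
  have coef_nonzeroE: "\<exists>g. g permutes \<Psi> \<and> m = mono g" if "coef w m \<noteq> 0" for w m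
    using that coef_other by blast
  have finite_coef: "finite {m. coef w m \<noteq> 0}" for w
  proof -
    obtain C where C: "finite C" "\<And>g. g permutes \<Psi> \<Longrightarrow> l (\<rho> (inv g) w) \<noteq> 0 \<Longrightarrow> g ` F \<subseteq> C"
      using fin[of w] by blast
    \<comment> \<open>\<open>mono\<close> makes sense for arbitrary functions and sees only their
      values on \<open>F\<close>.\<close>
    have "{m. coef w m \<noteq> 0} \<subseteq> mono ` (F \<rightarrow>\<^sub>E C)"
    proof
      fix m assume m: "m \<in> {m. coef w m \<noteq> 0}"
      then obtain g where g: "g permutes \<Psi>" "m = mono g" using coef_nonzeroE by blast
      then have "g ` F \<subseteq> C" using m C(2) coef_mono by simp
      then have "restrict g F \<in> F \<rightarrow>\<^sub>E C" by auto
      moreover have "m = mono (restrict g F)" using g(2) by (simp add: mono_def)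
      ultimately show "m \<in> mono ` (F \<rightarrow>\<^sub>E C)" by blast
    qed
    then show ?thesis using C(1) F(1) by (meson finite_PiE finite_imageI finite_subset)
  qed
  define P :: "'v \<Rightarrow> ('x, 'k) mpoly" where "P w = MPoly (Abs_poly_mapping (coef w))" for w
  have lookup_P: "Poly_Mapping.lookup (mapping_of (P w)) = coef w" for w
    by (simp add: P_def MPoly_inverse finite_coef)
  have P_eqI: "Q = P w" if "\<And>m. Poly_Mapping.lookup (mapping_of Q) m = coef w m" for Q w
    using that by (metis lookup_P mapping_of_inject poly_mapping_eqI)
  have coef_add: "coef (u + v) m = coef u m + coef v m" for u v m
  proof (cases "\<exists>g. g permutes \<Psi> \<and> m = mono g")
    case True
    then show ?thesis
      by (auto simp: coef_mono rep_add permutes_inv invariant_functional_add[OF l(1)])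
  qed (auto simp: coef_other)
  have coef_scale: "coef (scale c v) m = c * coef v m" for c v m
  proof (cases "\<exists>g. g permutes \<Psi> \<and> m = mono g")
    case True
    then show ?thesis
      by (auto simp: coef_mono rep_scale permutes_inv invariant_functional_scale[OF l(1)])
  qed (auto simp: coef_other)
  have P_add: "P (u + v) = P u + P v" for u v
    by (rule P_eqI[symmetric]) (simp add: plus_mpoly.rep_eq lookup_add lookup_P coef_add)
  have P_scale: "P (scale c v) = mpoly_const c * P v" for c v
    by (rule P_eqI[symmetric])
      (simp add: times_mpoly.rep_eq mpoly_const.rep_eq mult_map_scale_conv_mult[symmetric]
        map.rep_eq when_def lookup_P coef_scale)
  have P_rep: "P (\<rho> h w) = mpoly_rename h (P w)" if h: "h permutes \<Psi>" for h w
  proof (rule P_eqI[symmetric])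
    fix m
    have bij: "bij h" using h by (rule permutes_bij)
    have "coef w (Poly_Mapping.map_key h m) = coef (\<rho> h w) m"
    proof (cases "\<exists>g. g permutes \<Psi> \<and> m = mono g")
      case True
      then obtain g where g: "g permutes \<Psi>" "m = mono g" by blast
      have "inv (inv h \<circ> g) = inv g \<circ> h"
        using g(1) bij by (simp add: o_inv_distrib bij_imp_bij_inv permutes_bij inv_inv_eq)
      then show ?thesis
        using g h by (simp add: map_key_mono coef_mono permutes_compose permutes_inv rep_compose)
    next
      case False
      have "Poly_Mapping.map_key h m \<noteq> mono g" if g: "g permutes \<Psi>" for g
      proof
        assume "Poly_Mapping.map_key h m = mono g"
        also have "\<dots> = Poly_Mapping.map_key h (mono (h \<circ> g))"
          using h by (simp add: map_key_mono o_assoc permutes_inv_o)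
        finally have "m = mono (h \<circ> g)"
          by (rule injD[OF inj_map_key[OF bij]])
        then show False using False g h permutes_compose by blast
      qed
      then show ?thesis using False by (simp add: coef_other)
    qed
    then show "Poly_Mapping.lookup (mapping_of (mpoly_rename h (P w))) m = coef (\<rho> h w) m"
      by (simp add: mpoly_rename.rep_eq lookup_map_key inj_map_key bij lookup_P)
  qed
  define \<phi> :: "'v \<Rightarrow> ('x, 'k) ratfun" where "\<phi> w = Fract (P w) 1" for w
  have lin: "Vector_Spaces.linear scale ratfun_scale \<phi>"
    unfolding Vector_Spaces.linear_iff
    using vector_space_axioms vector_space_ratfun_scale
    by (simp add: \<phi>_def P_add P_scale ratfun_scale_def)
  have equi: "\<phi> (\<rho> g v) = ratfun_act g (\<phi> v)" if "g permutes \<Psi>" for g v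
    using that by (simp add: \<phi>_def P_rep ratfun_act_Fract permutes_bij mpoly_rename_1)
  interpret \<phi>: Vector_Spaces.linear scale ratfun_scale \<phi> by (rule lin)
  have "inj \<phi>"
  proof -
    let ?K = "{w. \<phi> w = 0}"
    have "?K = {0} \<or> ?K = UNIV"
    proof (rule irreducible_repD[OF irr])
      show "subspace ?K" by (rule \<phi>.subspace_kernel)
    qed (simp add: equi ratfun_act_0 permutes_bij)
    moreover have "\<phi> v0 \<noteq> 0"
    proof
      assume "\<phi> v0 = 0"
      then have "P v0 = 0" by (simp add: \<phi>_def Zero_fract_def eq_fract)
      \<comment> \<open>This coefficient is \<open>l v0\<close>.\<close>
      then have "coef v0 (mono id) = 0" by (metis lookup_P lookup_zero zero_mpoly.rep_eq)
      then show False using l(2) coef_mono[OF permutes_id] by (simp add: rep_id)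
    qed
    ultimately show ?thesis by (auto simp: \<phi>.inj_iff_eq_0)
  qed
  have "\<phi> w \<in> homogeneous_ratfuns \<Psi> (int (\<Sum>a\<in>F. e a))" for w
    unfolding \<phi>_def
  proof (rule homogeneous_ratfunsI)
    have monoms: "\<exists>g. g permutes \<Psi> \<and> m = mono g" if "m \<in> mpoly_monoms (P w)" for m
      using that coef_nonzeroE by (simp add: mpoly_monoms_def in_keys_iff lookup_P)
    show "homogeneous_mpoly (\<Sum>a\<in>F. e a) (P w)"
      unfolding homogeneous_mpoly_def using monoms
      by (fastforce simp: mono_def monom_degree_sum monom_degree_single)
    have "Poly_Mapping.keys (mono g) \<subseteq> \<Psi>" if "g permutes \<Psi>" for g
    proof
      fix y assume "y \<in> Poly_Mapping.keys (mono g)"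
      then have "y \<in> (\<Union>a\<in>F. Poly_Mapping.keys (Poly_Mapping.single (g a) (e a)))"
        unfolding mono_def using subsetD[OF keys_sum] by fast
      then have "y \<in> g ` F" by (auto split: if_splits)
      then show "y \<in> \<Psi>" using that F(2) by (auto simp: permutes_in_image)
    qed
    then show "mpoly_vars (P w) \<subseteq> \<Psi>"
      unfolding mpoly_vars_def using monoms by blast
    have one: "mpoly_monoms (1 :: ('x, 'k) mpoly) = {0}"
      by (simp add: mpoly_monoms_def one_mpoly.rep_eq)
    show "mpoly_vars (1 :: ('x, 'k) mpoly) \<subseteq> \<Psi>"
      by (simp add: mpoly_vars_def one)
    show "homogeneous_mpoly 0 (1 :: ('x, 'k) mpoly)"
      by (simp add: homogeneous_mpoly_def one monom_degree_def)
  qed simp_all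
  then show ?thesis using lin \<open>inj \<phi>\<close> equi by blast
qed

end

theorem corollary1p5:
  fixes \<Psi> :: "'x set"
    and scale :: "'k::field \<Rightarrow> 'v::ab_group_add \<Rightarrow> 'v"
    and \<rho> :: "('x \<Rightarrow> 'x) \<Rightarrow> 'v \<Rightarrow> 'v"
  assumes "sym_representation scale \<Psi> \<rho>"
    and "smooth_rep \<Psi> \<rho>"
    and "irreducible_rep scale \<Psi> \<rho>"
  shows "\<exists>(d::int) (\<phi> :: 'v \<Rightarrow> ('x, 'k) ratfun).
    Vector_Spaces.linear scale ratfun_scale \<phi> \<and> inj \<phi> \<and>
    range \<phi> \<subseteq> homogeneous_ratfuns \<Psi> d \<and>
    (\<forall>g v. g permutes \<Psi> \<longrightarrow> \<phi> (\<rho> g v) = ratfun_act g (\<phi> v))"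
proof -
  interpret sym_representation scale \<Psi> \<rho> by (rule assms(1))
  note smooth = assms(2) and irr = assms(3)
  show ?thesis
  proof (cases "finite \<Psi>")
    case True
    obtain v where "v \<noteq> (0::'v)" using irr by (auto simp: irreducible_rep_def)
    then obtain l v0 where l: "Vector_Spaces.linear scale (*) l" "l v0 \<noteq> 0"
      using ex_functional_vanishing_on[of "{0}"] by auto
    \<comment> \<open>With \<open>F = \<Psi>\<close> the stabilizer is trivial, so every linear
      functional is invariant.\<close>
    have "h = id" if "h \<in> pointwise_stabilizer \<Psi> \<Psi>" for h
      using pointwise_stabilizerD[OF that] by (metis eq_id_iff permutes_not_in)
    then have inv: "invariant_functional \<Psi> l"
      using l(1) rep_id unfolding invariant_functional_def by metis
    show ?thesis
      by (rule embeds_if_finitely_supported[OF irr True subset_refl inv l(2)])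
        (use True in \<open>auto simp: permutes_image intro!: exI[of _ \<Psi>]\<close>)
  next
    case False
    \<comment> \<open>The functional is quantified inside, so minimality of \<open>F\<close> also
      applies to the limit functional, which differs from \<open>l\<close>.\<close>
    define admissible where "admissible F \<longleftrightarrow>
      finite F \<and> F \<subseteq> \<Psi> \<and> (\<exists>l v. invariant_functional F l \<and> l v \<noteq> 0)" for F
    have "\<exists>F. admissible F"
      using ex_invariant_functional[OF smooth irr] unfolding admissible_def by blast
    then obtain F where F: "admissible F" and minimal: "\<And>F'. admissible F' \<Longrightarrow> card F \<le> card F'"
      using ex_has_least_nat[of admissible _ card] by blast
    obtain l v where l: "finite F" "F \<subseteq> \<Psi>" "invariant_functional F l" "l v \<noteq> 0"
      using F unfolding admissible_def by blast
    show ?thesis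
    proof (rule embeds_if_finitely_supported[OF irr l])
      fix w
      obtain C where C: "finite C" "supports C w"
        using smooth_imp_supports[OF smooth] by blast
      have card_le: "card F \<le> card F'" if "finite F'" "F' \<subseteq> \<Psi>" "invariant_functional F' l'" "l' u \<noteq> 0" for F' l' u
        using minimal that unfolding admissible_def by blast
      have "g ` F \<subseteq> C" if "g permutes \<Psi>" "l (\<rho> (inv g) w) \<noteq> 0" for g
        by (rule minimal_invariant_functional_support[OF smooth False l(1-3) _ C that]) (rule card_le)
      then show "\<exists>C. finite C \<and> (\<forall>g. g permutes \<Psi> \<longrightarrow> l (\<rho> (inv g) w) \<noteq> 0 \<longrightarrow> g ` F \<subseteq> C)"
        using C(1) by blast
    qed
  qed
qed

end
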